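(* Let $f=\sum_s\lambda_sF_s=\sum_i[[a_i^2]]$ be a sum of squares in $\mathcal{A}$, where the $F_s$ are the (distinct) unlabeled constituent graphs of $f$, and $a_i=\sum_j\alpha_{ij}H_{ij}$ with, for each $i$, distinct partially labeled graphs $H_{ij}$ and nonzero real coefficients $\alpha_{ij}$ (finitely many $i$ and $j$, and at least one $a_i$ nonzero). Let $d$ be the minimum degree of any product $H_{ij}H_{ik}$ of two constituent graphs within any $a_i$ (the case $j=k$ included). Then there exists a term $\lambda_sF_s$ in $f$ of degree $d$ such that $F_s$ only arises via squares $[[H_{ij}^2]]$ (that is, whenever $F_s=[[H_{ij}H_{ik}]]$ one has $j=k$), and consequently $\lambda_s>0$.
   Context: All graphs are finite and simple (no loops or multiple edges). A graph is partially labeled if some subset of its vertices (possibly empty, possibly all) carries pairwise distinct labels from $\mathbb{N}=\{1,2,3,\dots\}$, each vertex having at most one label; it is unlabeled if no vertex is labeled. Partially labeled graphs are identified up to label-preserving isomorphism. $\mathcal{A}$ is the real vector space of formal finite $\mathbb{R}$-linear combinations ("graph combinations") of partially labeled graphs without isolated vertices, including the empty graph, denoted $1$. The product $H_1H_2$ of two partially labeled graphs is obtained by taking the disjoint union, identifying vertices carrying the same label, and keeping only one copy of any doubled edge; extended bilinearly, this makes $\mathcal{A}$ a commutative $\mathbb{R}$-algebra with identity $1$. $\mathcal{A}_\emptyset$ is the subalgebra spanned by unlabeled graphs (where the product is disjoint union). The linear map $[[\cdot]]:\mathcal{A}\to\mathcal{A}_\emptyset$ removes all labels. The degree of a graph is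 its number of edges, and the degree of a term $\lambda F$ ($\lambda\neq0$) is the degree of $F$. A sum of squares (sos) is an element of $\mathcal{A}_\emptyset$ of the form $\sum_i[[a_i^2]]$, a finite sum with $a_i\in\mathcal{A}$. *)

theory Defs
  imports Complex_Main "HOL-Library.Poly_Mapping"
begin

text \<open>
  Labels are the positive integers.  Labels within one graph are pairwise distinct and only matter up
  to label-preserving isomorphism, so the vertex carrying the label \<open>i\<close> is taken to be
  \<open>Lab i\<close> itself; the vertices \<open>Unl n\<close> carry no label.
\<close>

datatype vertex = Lab nat | Unl nat

primrec label :: "vertex \<Rightarrow> nat option" where
  "label (Lab i) = Some i"
| "label (Unl n) = None"

text \<open>
  A graph without isolated vertices is given by its edge set \<open>E\<close>: its vertex set
  is \<open>\<Union>E\<close>.  Edges are two-element sets, hence there are no loops or multiple edges.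
\<close>

definition is_plg :: "vertex set set \<Rightarrow> bool" where
  "is_plg E \<longleftrightarrow> finite E \<and> (\<forall>e\<in>E. card e = 2) \<and> Lab 0 \<notin> \<Union>E"

definition plg_iso :: "vertex set set \<Rightarrow> vertex set set \<Rightarrow> bool" where
  "plg_iso E F \<longleftrightarrow> is_plg E \<and> is_plg F \<and>
     (\<exists>\<phi>. bij_betw \<phi> (\<Union>E) (\<Union>F) \<and> (\<forall>v\<in>\<Union>E. label (\<phi> v) = label v) \<and> F = (`) \<phi> ` E)"

lemma plg_isoI:
  assumes "is_plg E" "inj_on \<phi> (\<Union>E)" "\<And>v. v \<in> \<Union>E \<Longrightarrow> label (\<phi> v) = label v" "F = (`) \<phi> ` E"
  shows "plg_iso E F"
proof -
  have UF: "\<Union>F = \<phi> ` \<Union>E" using assms(4) by auto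
  have "card (\<phi> ` e) = 2" if "e \<in> E" for e
    using that assms(1) card_image[of \<phi> e] inj_on_subset[OF assms(2), of e]
    by (auto simp: is_plg_def)
  moreover have "Lab 0 \<notin> \<phi> ` \<Union>E"
  proof
    assume "Lab 0 \<in> \<phi> ` \<Union>E"
    then obtain v where v: "v \<in> \<Union>E" "\<phi> v = Lab 0" by (metis imageE)
    then have "label v = Some 0" using assms(3)[of v] by simp
    then have "v = Lab 0" by (cases v) auto
    then show False using v assms(1) by (auto simp: is_plg_def)
  qed
  moreover have "finite F" using assms(1,4) by (simp add: is_plg_def)
  ultimately have "is_plg F" unfolding is_plg_def UF using assms(4) by auto
  then show ?thesis using assms UF unfolding plg_iso_def bij_betw_def by blast
qed

lemma plg_iso_refl: "is_plg E \<Longrightarrow> plg_iso E E"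
  by (rule plg_isoI[of _ id]) auto

lemma plg_iso_sym:
  assumes "plg_iso E F" shows "plg_iso F E"
proof -
  obtain \<phi> where f: "is_plg E" "is_plg F" "bij_betw \<phi> (\<Union>E) (\<Union>F)"
    "\<forall>v\<in>\<Union>E. label (\<phi> v) = label v" "F = (`) \<phi> ` E"
    using assms unfolding plg_iso_def by blast
  let ?g = "the_inv_into (\<Union>E) \<phi>"
  have inj: "inj_on \<phi> (\<Union>E)" using f(3) by (simp add: bij_betw_def)
  have gf: "?g (\<phi> v) = v" if "v \<in> \<Union>E" for v using the_inv_into_f_f[OF inj that] .
  have "?g ` \<phi> ` e = e" if "e \<in> E" for e
    using that gf by (force simp: image_image)
  then have "(`) ?g ` F = E" unfolding f(5) image_image by simp
  moreover have "inj_on ?g (\<Union>F)" using f(3) by (metis bij_betw_def inj_on_the_inv_into)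
  moreover have "label (?g v) = label v" if "v \<in> \<Union>F" for v
  proof -
    from that f(3) obtain w where "w \<in> \<Union>E" "v = \<phi> w" by (metis bij_betw_def imageE)
    then show ?thesis using f(4) gf by metis
  qed
  ultimately show ?thesis using plg_isoI[OF f(2)] by metis
qed

lemma plg_iso_trans:
  assumes "plg_iso E F" "plg_iso F G" shows "plg_iso E G"
proof -
  obtain \<phi> where f: "is_plg E" "bij_betw \<phi> (\<Union>E) (\<Union>F)"
    "\<forall>v\<in>\<Union>E. label (\<phi> v) = label v" "F = (`) \<phi> ` E"
    using assms(1) unfolding plg_iso_def by blast
  obtain \<psi> where g: "bij_betw \<psi> (\<Union>F) (\<Union>G)"
    "\<forall>v\<in>\<Union>F. label (\<psi> v) = label v" "G = (`) \<psi> ` F"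
    using assms(2) unfolding plg_iso_def by blast
  show ?thesis
  proof (rule plg_isoI[OF f(1)])
    show "inj_on (\<psi> \<circ> \<phi>) (\<Union>E)" using f(2) g(1) by (metis bij_betw_def bij_betw_trans)
    show "label ((\<psi> \<circ> \<phi>) v) = label v" if "v \<in> \<Union>E" for v
    proof -
      have "\<phi> v \<in> \<Union>F" using that f(2) by (metis bij_betw_apply)
      then show ?thesis using that f(3) g(2) by (metis comp_apply)
    qed
    show "G = (`) (\<psi> \<circ> \<phi>) ` E" using f(4) g(3) by (simp add: image_image image_comp)
  qed
qed

quotient_type plgraph = "vertex set set" / partial: plg_iso
proof (rule part_equivpI)
  show "\<exists>E. plg_iso E E" by (rule exI[of _ "{}"], rule plg_iso_refl) (simp add: is_plg_def)
  show "symp plg_iso" by (rule sympI) (rule plg_iso_sym)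
  show "transp plg_iso" by (rule transpI) (rule plg_iso_trans)
qed

lift_definition graph_degree :: "plgraph \<Rightarrow> nat" is card
proof -
  fix E F assume "plg_iso E F"
  then obtain \<phi> where "inj_on \<phi> (\<Union>E)" "F = (`) \<phi> ` E"
    unfolding plg_iso_def bij_betw_def by blast
  then show "card E = card F" by (simp add: card_image inj_on_image)
qed

lift_definition unlabeled :: "plgraph \<Rightarrow> bool" is "\<lambda>E. \<forall>v\<in>\<Union>E. label v = None"
  by (auto simp: plg_iso_def bij_betw_def)

lift_definition empty_plgraph :: plgraph is "{}"
  by (rule plg_iso_refl) (simp add: is_plg_def)

text \<open>
  In the gluing product, \<open>inl\<close> and \<open>inr\<close> make the unlabeled vertices of the two factors disjoint
  while equally labeled vertices are identified.  The union of the resulting edge sets contains only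
  one copy of a doubled edge.
\<close>

primrec inl :: "vertex \<Rightarrow> vertex" where
  "inl (Lab i) = Lab i"
| "inl (Unl n) = Unl (2 * n)"

primrec inr :: "vertex \<Rightarrow> vertex" where
  "inr (Lab i) = Lab i"
| "inr (Unl n) = Unl (2 * n + 1)"

primrec strip :: "vertex \<Rightarrow> vertex" where
  "strip (Lab i) = Unl (2 * i)"
| "strip (Unl n) = Unl (2 * n + 1)"

lemma inl_inj: "inl v = inl w \<longleftrightarrow> v = w"
  by (cases v; cases w) auto

lemma inr_inj: "inr v = inr w \<longleftrightarrow> v = w"
  by (cases v; cases w) auto

lemma inl_eq_inr: "inl v = inr w \<longleftrightarrow> v = w \<and> label v \<noteq> None"
  by (cases v; cases w) (auto, presburger)

lemma strip_inj: "strip v = strip w \<longleftrightarrow> v = w"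
  by (cases v; cases w) (auto, presburger+)

lemma label_inl [simp]: "label (inl v) = label v" by (cases v) auto
lemma label_inr [simp]: "label (inr v) = label v" by (cases v) auto
lemma label_strip [simp]: "label (strip v) = None" by (cases v) auto

lemma label_Some_iff: "label v = Some i \<longleftrightarrow> v = Lab i"
  by (cases v) auto

definition glue0 :: "vertex set set \<Rightarrow> vertex set set \<Rightarrow> vertex set set" where
  "glue0 E F = (`) inl ` E \<union> (`) inr ` F"

lemma is_plg_glue0:
  assumes "is_plg E" "is_plg F" shows "is_plg (glue0 E F)"
proof -
  have "card (inl ` e) = card e" for e by (rule card_image) (simp add: inj_on_def inl_inj)
  moreover have "card (inr ` e) = card e" for e by (rule card_image) (simp add: inj_on_def inr_inj)
  moreover have "inl v = Lab 0 \<longleftrightarrow> v = Lab 0" "inr v = Lab 0 \<longleftrightarrow> v = Lab 0" for v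
    by (cases v; simp)+
  ultimately show ?thesis using assms unfolding is_plg_def glue0_def
    by (auto simp: eq_commute[of "Lab 0"])
qed

lemma is_plg_strip:
  assumes "is_plg E" shows "is_plg ((`) strip ` E)"
proof -
  have "card (strip ` e) = card e" for e by (rule card_image) (simp add: inj_on_def strip_inj)
  moreover have "strip v \<noteq> Lab 0" for v by (cases v) auto
  ultimately show ?thesis using assms unfolding is_plg_def
    by (auto simp: eq_commute[of "Lab 0"])
qed

lemma glue0_cong:
  assumes "plg_iso E E'" "plg_iso F F'" shows "plg_iso (glue0 E F) (glue0 E' F')"
proof -
  obtain \<phi> where f: "is_plg E" "inj_on \<phi> (\<Union>E)" "\<forall>v\<in>\<Union>E. label (\<phi> v) = label v" "E' = (`) \<phi> ` E"
    using assms(1) unfolding plg_iso_def bij_betw_def by blast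
  obtain \<psi> where g: "is_plg F" "inj_on \<psi> (\<Union>F)" "\<forall>v\<in>\<Union>F. label (\<psi> v) = label v" "F' = (`) \<psi> ` F"
    using assms(2) unfolding plg_iso_def bij_betw_def by blast
  define \<chi> where "\<chi> v = (case v of Lab i \<Rightarrow> Lab i
     | Unl m \<Rightarrow> if even m then inl (\<phi> (Unl (m div 2))) else inr (\<psi> (Unl (m div 2))))" for v
  have cl: "\<chi> (inl v) = inl (\<phi> v)" if "v \<in> \<Union>E" for v
    using f(3)[rule_format, OF that] by (cases v) (auto simp: \<chi>_def label_Some_iff)
  have cr: "\<chi> (inr v) = inr (\<psi> v)" if "v \<in> \<Union>F" for v
    using g(3)[rule_format, OF that] by (cases v) (auto simp: \<chi>_def label_Some_iff)
  have U: "\<Union>(glue0 E F) = inl ` \<Union>E \<union> inr ` \<Union>F" unfolding glue0_def by auto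
  show ?thesis
  proof (rule plg_isoI[of _ \<chi>])
    show "is_plg (glue0 E F)" using f(1) g(1) by (rule is_plg_glue0)
    show "label (\<chi> v) = label v" if v: "v \<in> \<Union>(glue0 E F)" for v
    proof -
      consider w where "w \<in> \<Union>E" "v = inl w" | w where "w \<in> \<Union>F" "v = inr w"
        using v unfolding U by blast
      then show ?thesis
        by cases (use f(3) g(3) cl cr in \<open>metis label_inl label_inr\<close>)+
    qed
    have cross: "inl v = inr w" if "v \<in> \<Union>E" "w \<in> \<Union>F" "\<chi> (inl v) = \<chi> (inr w)" for v w
    proof -
      have "inl (\<phi> v) = inr (\<psi> w)" using that cl cr by metis
      then have e: "\<phi> v = \<psi> w" "label (\<phi> v) \<noteq> None" by (auto simp: inl_eq_inr)
      then obtain i where i: "label (\<phi> v) = Some i" by auto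
      then have "label v = Some i" "label w = Some i" using f(3) g(3) that e(1) by metis+
      then show ?thesis by (simp add: label_Some_iff)
    qed
    show "inj_on \<chi> (\<Union>(glue0 E F))" unfolding U
    proof (rule inj_onI)
      fix x y assume x: "x \<in> inl ` \<Union>E \<union> inr ` \<Union>F" and y: "y \<in> inl ` \<Union>E \<union> inr ` \<Union>F"
        and eq: "\<chi> x = \<chi> y"
      consider v w where "v \<in> \<Union>E" "w \<in> \<Union>E" "x = inl v" "y = inl w"
        | v w where "v \<in> \<Union>F" "w \<in> \<Union>F" "x = inr v" "y = inr w"
        | v w where "v \<in> \<Union>E" "w \<in> \<Union>F" "x = inl v" "y = inr w"
        | v w where "v \<in> \<Union>F" "w \<in> \<Union>E" "x = inr v" "y = inl w"
        using x y by blast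
      then show "x = y"
      proof cases
        case 1 then show ?thesis using eq f(2) cl by (metis inj_onD inl_inj)
      next
        case 2 then show ?thesis using eq g(2) cr by (metis inj_onD inr_inj)
      next
        case 3 then show ?thesis using eq cross by metis
      next
        case 4 then show ?thesis using eq cross by metis
      qed
    qed
    have "\<chi> ` inl ` e = inl ` \<phi> ` e" if "e \<in> E" for e
      unfolding image_image using that by (intro image_cong) (auto intro: cl)
    moreover have "\<chi> ` inr ` e = inr ` \<psi> ` e" if "e \<in> F" for e
      unfolding image_image using that by (intro image_cong) (auto intro: cr)
    ultimately show "glue0 E' F' = (`) \<chi> ` glue0 E F"
      unfolding glue0_def f(4) g(4) image_Un by (simp add: image_comp cong: image_cong)
  qed
qed

lift_definition glue :: "plgraph \<Rightarrow> plgraph \<Rightarrow> plgraph" is glue0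
  by (rule glue0_cong)

lift_definition unlabel :: "plgraph \<Rightarrow> plgraph" is "\<lambda>E. (`) strip ` E"
proof -
  fix E F assume "plg_iso E F"
  then obtain \<phi> where f: "is_plg E" "inj_on \<phi> (\<Union>E)" "F = (`) \<phi> ` E"
    unfolding plg_iso_def bij_betw_def by blast
  let ?g = "inv strip"
  have g: "?g (strip v) = v" for v by (rule inv_f_f) (simp add: inj_def strip_inj)
  have U: "\<Union>((`) strip ` E) = strip ` \<Union>E" by auto
  show "plg_iso ((`) strip ` E) ((`) strip ` F)"
  proof (rule plg_isoI[of _ "strip \<circ> \<phi> \<circ> ?g"])
    show "inj_on (strip \<circ> \<phi> \<circ> ?g) (\<Union>((`) strip ` E))"
      unfolding U using f(2) by (auto simp: inj_on_def g strip_inj)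
    show "(`) strip ` F = (`) (strip \<circ> \<phi> \<circ> ?g) ` (`) strip ` E"
      unfolding f(3) by (simp add: image_image g)
    show "label ((strip \<circ> \<phi> \<circ> ?g) v) = label v" if "v \<in> \<Union>((`) strip ` E)" for v
      using that unfolding U by auto
  qed (rule is_plg_strip[OF f(1)])
qed

lemma unlabeled_unlabel: "unlabeled (unlabel H)"
  by transfer auto

lemma unlabel_unlabeled: "unlabeled H \<Longrightarrow> unlabel H = H"
proof (transfer)
  fix E assume "plg_iso E E" and n: "\<forall>v\<in>\<Union>E. label v = None"
  then have "is_plg E" by (simp add: plg_iso_def)
  then have "plg_iso E ((`) strip ` E)"
    using n by (intro plg_isoI[of _ strip]) (auto simp: inj_on_def strip_inj)
  then show "plg_iso ((`) strip ` E) E" by (rule plg_iso_sym)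
qed

lemma glue_empty: "glue empty_plgraph H = H"
proof (transfer)
  fix E assume "plg_iso E E"
  then have "is_plg E" by (simp add: plg_iso_def)
  then have "plg_iso E ((`) inr ` E)"
    by (intro plg_isoI[of _ inr]) (auto simp: inj_on_def inr_inj)
  then show "plg_iso (glue0 {} E) E" by (simp add: glue0_def plg_iso_sym)
qed

lemma glue_commute: "glue H K = glue K H"
proof (transfer)
  fix E F assume "plg_iso E E" "plg_iso F F"
  then have EF: "is_plg (glue0 E F)" by (simp add: plg_iso_def is_plg_glue0)
  define t where "t v = (case v of Lab i \<Rightarrow> Lab i
     | Unl m \<Rightarrow> Unl (if even m then m + 1 else m - 1))" for v
  have tl: "t (inl v) = inr v" and tr: "t (inr v) = inl v" for v
    by (cases v; simp add: t_def)+
  have tt: "t (t v) = v" for v by (auto simp: t_def split: vertex.split)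
  show "plg_iso (glue0 E F) (glue0 F E)"
  proof (rule plg_isoI[OF EF, of t])
    show "inj_on t (\<Union>(glue0 E F))" by (metis inj_onI tt)
    show "label (t v) = label v" for v by (simp add: t_def split: vertex.split)
    show "glue0 F E = (`) t ` glue0 E F"
      unfolding glue0_def image_Un by (simp add: image_image tl tr Un_commute)
  qed
qed

lemma glue_assoc: "glue (glue H K) L = glue H (glue K L)"
proof (transfer)
  fix E F G assume "plg_iso E E" "plg_iso F F" "plg_iso G G"
  then have P: "is_plg (glue0 (glue0 E F) G)" by (simp add: plg_iso_def is_plg_glue0)
  define t where "t v = (case v of Lab i \<Rightarrow> Lab i
     | Unl m \<Rightarrow> Unl (if m mod 4 = 0 then m div 2 else if m mod 4 = 2 then m - 1 else 2 * m + 1))" for v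
  have t1: "t (inl (inl v)) = inl v" for v by (cases v) (simp_all add: t_def)
  have t2: "t (inl (inr v)) = inr (inl v)" for v
  proof (cases v)
    case (Unl n)
    have "2 * (2 * n + 1) mod 4 = 2" by presburger
    then show ?thesis using Unl by (simp add: t_def)
  qed (simp add: t_def)
  have t3: "t (inr v) = inr (inr v)" for v
  proof (cases v)
    case (Unl n)
    have "(2 * n + 1) mod 4 \<noteq> 0" "(2 * n + 1) mod 4 \<noteq> 2" by presburger+
    then show ?thesis using Unl by (simp add: t_def)
  qed (simp add: t_def)
  have inj: "inj_on t (\<Union>(glue0 (glue0 E F) G))"
  proof -
    let ?s = "\<lambda>v. case v of Lab i \<Rightarrow> Lab i
      | Unl m \<Rightarrow> Unl (if even m then 2 * m else if m mod 4 = 1 then m + 1 else m div 2)"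
    have "?s (t v) = v" for v
    proof (cases v)
      case (Unl m)
      have "m mod 4 = 0 \<or> m mod 4 = 2 \<or> odd m" by presburger
      then consider k where "m = 4 * k" | k where "m = 4 * k + 2" | k where "m = 2 * k + 1"
        by (metis oddE mult_div_mod_eq add.right_neutral)
      then show ?thesis
      proof cases
        case 1 then show ?thesis using Unl by (simp add: t_def)
      next
        case 2
        have "(4 * k + 2) mod 4 = 2" "(4 * k + 1) mod 4 = 1" by presburger+
        then show ?thesis using Unl 2 by (simp add: t_def)
      next
        case 3
        have m: "m mod 4 \<noteq> 0" "m mod 4 \<noteq> 2" "odd (2 * m + 1)" "(2 * m + 1) mod 4 \<noteq> 1"
          "(2 * m + 1) div 2 = m" using 3 by presburger+
        have "t v = Unl (2 * m + 1)" using Unl m(1,2) by (simp add: t_def)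
        then show ?thesis using Unl m(3-5) by (simp del: mod_mult_self1 div_mult_self1)
      qed
    qed (simp add: t_def)
    then show ?thesis by (rule inj_on_inverseI)
  qed
  show "plg_iso (glue0 (glue0 E F) G) (glue0 E (glue0 F G))"
  proof (rule plg_isoI[OF P, of t])
    show "inj_on t (\<Union>(glue0 (glue0 E F) G))" by (rule inj)
    show "label (t v) = label v" for v by (simp add: t_def split: vertex.split)
    show "glue0 E (glue0 F G) = (`) t ` glue0 (glue0 E F) G"
      unfolding glue0_def image_Un by (simp add: image_image t1 t2 t3 Un_assoc)
  qed
qed

text \<open>
  Gluing is registered as addition because the product of \<open>'a \<Rightarrow>\<^sub>0 'b\<close> is the bilinear extension of
  the addition of \<open>'a\<close>.
\<close>

instantiation plgraph :: comm_monoid_add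
begin

definition zero_plgraph :: plgraph where
  "zero_plgraph = empty_plgraph"

definition plus_plgraph :: "plgraph \<Rightarrow> plgraph \<Rightarrow> plgraph" where
  "plus_plgraph = glue"

instance
proof
  fix H K L :: plgraph
  show "H + K + L = H + (K + L)" unfolding plus_plgraph_def by (rule glue_assoc)
  show "H + K = K + H" unfolding plus_plgraph_def by (rule glue_commute)
  show "0 + H = H" unfolding plus_plgraph_def zero_plgraph_def by (rule glue_empty)
qed

end

text \<open>
  The constituent graphs of \<open>a\<close> are \<open>Poly_Mapping.keys a\<close>; the (nonzero) coefficient of a
  constituent graph \<open>H\<close> is \<open>Poly_Mapping.lookup a H\<close>.
\<close>

type_synonym graph_comb = "plgraph \<Rightarrow>\<^sub>0 real"

lemma graph_comb_expansion:
  "a = (\<Sum>H\<in>Poly_Mapping.keys a. Poly_Mapping.single H (Poly_Mapping.lookup a H))"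
  for a :: graph_comb
  by (rule poly_mapping_eqI) (auto simp: lookup_sum lookup_single when_def in_keys_iff)

lemma graph_comb_one: "(1 :: graph_comb) = Poly_Mapping.single empty_plgraph 1"
  by (metis single_one zero_plgraph_def)

lemma graph_comb_mult_single:
  "Poly_Mapping.single H \<alpha> * Poly_Mapping.single K \<beta> = Poly_Mapping.single (glue H K) (\<alpha> * \<beta>)"
  for \<alpha> \<beta> :: real
  by (simp add: mult_single plus_plgraph_def)

definition unlabeled_combs :: "graph_comb set" where
  "unlabeled_combs = {f. \<forall>F\<in>Poly_Mapping.keys f. unlabeled F}"

definition unlabel_comb :: "graph_comb \<Rightarrow> graph_comb" where
  "unlabel_comb a = (\<Sum>H\<in>Poly_Mapping.keys a. Poly_Mapping.single (unlabel H) (Poly_Mapping.lookup a H))"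

lemma unlabel_comb_in_unlabeled_combs: "unlabel_comb a \<in> unlabeled_combs"
proof -
  have "Poly_Mapping.keys (unlabel_comb a) \<subseteq>
    (\<Union>H\<in>Poly_Mapping.keys a. Poly_Mapping.keys (Poly_Mapping.single (unlabel H) (Poly_Mapping.lookup a H)))"
    unfolding unlabel_comb_def by (rule keys_sum)
  then show ?thesis
    by (auto simp: unlabeled_combs_def unlabeled_unlabel split: if_splits)
qed

end

theory Submission
  imports Defs "HOL-Library.FuncSet"
begin

text \<open>
  Fix a target graph \<open>G\<close> on a finite vertex set \<open>W\<close> and an image in \<open>W\<close> for every label.  The densities
  of homomorphisms into \<open>G\<close> extending this placement of the labels are multiplicative under gluing, so
  summing over all placements and all \<open>G\<close> gives a functional \<open>\<beta>\<close> on unlabeled graphs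
  whose value at \<open>[[HK]]\<close> is the inner product of vectors \<open>v H\<close> and \<open>v K\<close>.  When \<open>W\<close> is large
  enough, \<open>v\<close> is injective: the densities determine those of the edge-surjective homomorphisms, and
  two finite graphs with edge-surjective homomorphisms in both directions are isomorphic.

  Since \<open>deg(HH) + deg(KK) \<le> 2 deg(HK)\<close>, a product \<open>HK\<close> of minimum degree \<open>d\<close> comes from graphs whose
  squares have degree \<open>d\<close>.  Among these squares choose \<open>F\<close> with \<open>\<beta> F\<close> maximal.  If \<open>F = [[HK]]\<close>, then
  neither \<open>v H\<close> nor \<open>v K\<close> has squared length above their inner product \<open>\<beta> F\<close>, so
  \<open>v H = v K\<close> and hence \<open>H = K\<close>.
\<close>

subsection \<open>Homomorphism densities\<close>

lemma image_image_cong: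
  assumes "\<And>v. v \<in> \<Union>A \<Longrightarrow> f v = g v"
  shows "(`) f ` A = (`) g ` A"
  using assms by (intro image_cong refl) auto

text \<open>\<open>G\<close> is any family of vertex sets, not only a graph: a map may collapse an
  edge to a singleton, which \<open>G\<close> is allowed to contain. Dividing by the number of all
  maps makes the value insensitive to isolated vertices added to the domain.\<close>

definition hom_density :: "vertex set \<Rightarrow> vertex set set \<Rightarrow> vertex set set \<Rightarrow> real" where
  "hom_density W G E =
     card {\<psi> \<in> \<Union>E \<rightarrow>\<^sub>E W. (`) \<psi> ` E \<subseteq> G} / card W ^ card (\<Union>E)"

text \<open>A vertex of \<open>D\<close> outside the graph can go anywhere in \<open>W\<close>; its
  \<open>card W\<close> choices cancel against its factor in the denominator.\<close>

lemma hom_density_superset: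
  assumes "finite D" "\<Union>E \<subseteq> D" "finite W" "W \<noteq> {}"
  shows "hom_density W G E = card {\<psi> \<in> D \<rightarrow>\<^sub>E W. (`) \<psi> ` E \<subseteq> G} / card W ^ card D"
proof -
  let ?A = "{\<psi> \<in> \<Union>E \<rightarrow>\<^sub>E W. (`) \<psi> ` E \<subseteq> G}" and ?B = "D - \<Union>E \<rightarrow>\<^sub>E W"
  let ?C = "{\<psi> \<in> D \<rightarrow>\<^sub>E W. (`) \<psi> ` E \<subseteq> G}"
  let ?m = "\<lambda>(\<alpha>, \<beta>) v. if v \<in> \<Union>E then \<alpha> v else \<beta> v"
  let ?r = "\<lambda>\<psi>. (restrict \<psi> (\<Union>E), restrict \<psi> (D - \<Union>E))"
  have "bij_betw ?m (?A \<times> ?B) ?C"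
  proof (rule bij_betw_byWitness[where f' = ?r])
    show "\<forall>p\<in>?A \<times> ?B. ?r (?m p) = p"
      by (auto simp: fun_eq_iff restrict_def PiE_def extensional_def)
    show "\<forall>\<psi>\<in>?C. ?m (?r \<psi>) = \<psi>"
      by (auto simp: fun_eq_iff restrict_def PiE_def extensional_def)
    show "?m ` (?A \<times> ?B) \<subseteq> ?C"
    proof (rule image_subsetI)
      fix p assume p: "p \<in> ?A \<times> ?B"
      obtain \<alpha> \<beta> where p_eq: "p = (\<alpha>, \<beta>)" by (cases p)
      have a: "\<alpha> \<in> \<Union>E \<rightarrow>\<^sub>E W" "(`) \<alpha> ` E \<subseteq> G" and b: "\<beta> \<in> ?B"
        using p unfolding p_eq by auto
      have "(`) (?m (\<alpha>, \<beta>)) ` E = (`) \<alpha> ` E" by (rule image_image_cong) auto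
      moreover have "?m (\<alpha>, \<beta>) \<in> D \<rightarrow>\<^sub>E W"
      proof (rule PiE_I)
        show "?m (\<alpha>, \<beta>) v \<in> W" if "v \<in> D" for v
          using that PiE_mem[OF a(1), of v] PiE_mem[OF b, of v] by (auto simp del: Union_iff)
        show "?m (\<alpha>, \<beta>) v = undefined" if "v \<notin> D" for v
          using that PiE_arb[OF b, of v] subsetD[OF assms(2), of v] by (auto simp del: Union_iff)
      qed
      ultimately show "?m p \<in> ?C" unfolding p_eq using a(2) by (simp only: mem_Collect_eq simp_thms)
    qed
    show "?r ` ?C \<subseteq> ?A \<times> ?B"
    proof (rule image_subsetI)
      fix \<psi> assume "\<psi> \<in> ?C"
      then have p: "\<psi> \<in> D \<rightarrow>\<^sub>E W" "(`) \<psi> ` E \<subseteq> G" by simp_all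
      have "(`) (restrict \<psi> (\<Union>E)) ` E = (`) \<psi> ` E" by (rule image_image_cong) (simp del: Union_iff)
      moreover have "\<psi> v \<in> W" if "v \<in> D" for v using PiE_mem[OF p(1) that] .
      then have "restrict \<psi> (\<Union>E) \<in> \<Union>E \<rightarrow>\<^sub>E W" "restrict \<psi> (D - \<Union>E) \<in> ?B"
        using subsetD[OF assms(2)] by (intro restrict_PiE_iff[THEN iffD2] ballI; blast)+
      ultimately show "?r \<psi> \<in> ?A \<times> ?B"
        using p(2) by (simp only: mem_Times_iff fst_conv snd_conv mem_Collect_eq simp_thms)
    qed
  qed
  then have "card ?C = card ?A * card ?B"
    unfolding card_cartesian_product[symmetric] by (rule bij_betw_same_card[symmetric])
  also have "card ?B = card W ^ card (D - \<Union>E)" using assms(1) by (simp add: card_PiE)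
  finally have "card ?C = card ?A * card W ^ card (D - \<Union>E)" .
  moreover have "card D = card (\<Union>E) + card (D - \<Union>E)"
    using assms(1,2) by (metis card_Un_disjoint Diff_disjoint Diff_partition finite_Diff finite_subset)
  moreover have "card W \<noteq> 0" using assms(3,4) by simp
  ultimately show ?thesis unfolding hom_density_def by (simp add: power_add)
qed

text \<open>Precomposition with \<phi> matches the maps on the two vertex sets. Labels are ignored
  here, so the result covers both isomorphisms and \<open>strip\<close>.\<close>

lemma hom_density_image:
  assumes "inj_on \<phi> (\<Union>E)"
  shows "hom_density W G ((`) \<phi> ` E) = hom_density W G E"
proof -
  let ?F = "(`) \<phi> ` E" and ?g = "the_inv_into (\<Union>E) \<phi>"
  have UF: "\<Union>?F = \<phi> ` \<Union>E" by auto
  have gf: "?g (\<phi> v) = v" if "v \<in> \<Union>E" for v using the_inv_into_f_f[OF assms that] .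
  let ?A = "{\<psi> \<in> \<Union>?F \<rightarrow>\<^sub>E W. (`) \<psi> ` ?F \<subseteq> G}" and ?B = "{\<psi> \<in> \<Union>E \<rightarrow>\<^sub>E W. (`) \<psi> ` E \<subseteq> G}"
  have ii: "(`) f ` ?F = (`) (f \<circ> \<phi>) ` E" for f :: "vertex \<Rightarrow> vertex"
    by (simp add: image_image image_comp)
  have "bij_betw (\<lambda>\<psi>. restrict (\<psi> \<circ> \<phi>) (\<Union>E)) ?A ?B"
  proof (rule bij_betw_byWitness[where f' = "\<lambda>\<psi>. restrict (\<psi> \<circ> ?g) (\<Union>?F)"])
    show "\<forall>\<psi>\<in>?A. restrict (restrict (\<psi> \<circ> \<phi>) (\<Union>E) \<circ> ?g) (\<Union>?F) = \<psi>"
      unfolding UF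
    proof (intro ballI ext)
      fix \<psi> v assume "\<psi> \<in> {\<psi> \<in> \<phi> ` \<Union>E \<rightarrow>\<^sub>E W. (`) \<psi> ` ?F \<subseteq> G}"
      then have p: "\<psi> \<in> \<phi> ` \<Union>E \<rightarrow>\<^sub>E W" by simp
      show "restrict (restrict (\<psi> \<circ> \<phi>) (\<Union>E) \<circ> ?g) (\<phi> ` \<Union>E) v = \<psi> v"
      proof (cases "v \<in> \<phi> ` \<Union>E")
        case True
        then obtain w where "w \<in> \<Union>E" "v = \<phi> w" by (rule imageE)
        then show ?thesis by (simp add: gf imageI del: Union_iff)
      next
        case False
        then show ?thesis using PiE_arb[OF p False] by (simp del: Union_iff)
      qed
    qed
    show "\<forall>\<psi>\<in>?B. restrict (restrict (\<psi> \<circ> ?g) (\<Union>?F) \<circ> \<phi>) (\<Union>E) = \<psi>"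
      unfolding UF
    proof (intro ballI ext)
      fix \<psi> v assume "\<psi> \<in> ?B"
      then have "\<psi> \<in> \<Union>E \<rightarrow>\<^sub>E W" by simp
      from PiE_arb[OF this, of v] show "restrict (restrict (\<psi> \<circ> ?g) (\<phi> ` \<Union>E) \<circ> \<phi>) (\<Union>E) v = \<psi> v"
        by (cases "v \<in> \<Union>E") (simp_all add: gf imageI del: Union_iff)
    qed
    show "(\<lambda>\<psi>. restrict (\<psi> \<circ> \<phi>) (\<Union>E)) ` ?A \<subseteq> ?B"
    proof (rule image_subsetI)
      fix \<psi> assume "\<psi> \<in> ?A"
      then have p: "\<psi> \<in> \<phi> ` \<Union>E \<rightarrow>\<^sub>E W" "(`) \<psi> ` ?F \<subseteq> G" unfolding UF by blast+
      have "(`) (restrict (\<psi> \<circ> \<phi>) (\<Union>E)) ` E = (`) \<psi> ` ?F"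
        unfolding ii by (rule image_image_cong) (simp del: Union_iff)
      moreover have "restrict (\<psi> \<circ> \<phi>) (\<Union>E) \<in> \<Union>E \<rightarrow>\<^sub>E W"
        using PiE_mem[OF p(1) imageI] by (simp del: Union_iff)
      ultimately show "restrict (\<psi> \<circ> \<phi>) (\<Union>E) \<in> ?B"
        using p(2) by (simp only: mem_Collect_eq simp_thms)
    qed
    show "(\<lambda>\<psi>. restrict (\<psi> \<circ> ?g) (\<Union>?F)) ` ?B \<subseteq> ?A"
    proof (rule image_subsetI)
      fix \<psi> assume "\<psi> \<in> ?B"
      then have p: "\<psi> \<in> \<Union>E \<rightarrow>\<^sub>E W" "(`) \<psi> ` E \<subseteq> G" by simp_all
      have "(`) (restrict (\<psi> \<circ> ?g) (\<Union>?F)) ` ?F = (`) \<psi> ` E"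
        unfolding ii UF by (rule image_image_cong) (simp add: gf del: Union_iff)
      moreover have "restrict (\<psi> \<circ> ?g) (\<Union>?F) \<in> \<Union>?F \<rightarrow>\<^sub>E W"
        unfolding UF using PiE_mem[OF p(1)]
        by (intro restrict_PiE_iff[THEN iffD2] ballI, elim imageE) (simp add: gf del: Union_iff)
      ultimately show "restrict (\<psi> \<circ> ?g) (\<Union>?F) \<in> ?A"
        using p(2) by (simp only: mem_Collect_eq simp_thms)
    qed
  qed
  then have "card ?A = card ?B" by (rule bij_betw_same_card)
  moreover have "card (\<Union>?F) = card (\<Union>E)" unfolding UF by (rule card_image[OF assms])
  ultimately show ?thesis unfolding hom_density_def by simp
qed

lemma hom_density_iso: "plg_iso E F \<Longrightarrow> hom_density W G E = hom_density W G F"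
  unfolding plg_iso_def bij_betw_def by (metis hom_density_image)

lift_definition plg_density :: "vertex set \<Rightarrow> vertex set set \<Rightarrow> plgraph \<Rightarrow> real" is hom_density
  by (rule hom_density_iso)

section \<open>Densities relative to a fixed placement of the labels\<close>

definition unl :: "vertex set set \<Rightarrow> vertex set" where
  "unl E = \<Union>E - range Lab"

definition extend :: "(vertex \<Rightarrow> vertex) \<Rightarrow> (vertex \<Rightarrow> vertex) \<Rightarrow> vertex \<Rightarrow> vertex" where
  "extend \<phi> \<psi> v = (if v \<in> range Lab then \<phi> v else \<psi> v)"

definition rooted_density :: "vertex set \<Rightarrow> (vertex \<Rightarrow> vertex) \<Rightarrow> vertex set set \<Rightarrow> vertex set set \<Rightarrow> real" where
  "rooted_density W \<phi> G E =
     card {\<psi> \<in> unl E \<rightarrow>\<^sub>E W. (`) (extend \<phi> \<psi>) ` E \<subseteq> G} / card W ^ card (unl E)"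

definition surj_density :: "vertex set \<Rightarrow> (vertex \<Rightarrow> vertex) \<Rightarrow> vertex set set \<Rightarrow> vertex set set \<Rightarrow> real" where
  "surj_density W \<phi> G E =
     card {\<psi> \<in> unl E \<rightarrow>\<^sub>E W. (`) (extend \<phi> \<psi>) ` E = G} / card W ^ card (unl E)"

lemma finite_Union_plg: "is_plg E \<Longrightarrow> finite (\<Union>E)"
  unfolding is_plg_def by (metis card.infinite finite_Union zero_neq_numeral)

text \<open>Once the labels are placed, a homomorphism from the glued graph is a pair of independent
  homomorphisms from the factors. \<open>L\<close> may contain labels absent from both graphs, so
  that one \<open>L\<close> can serve a whole family; \<open>hom_density_superset\<close> absorbs
  the surplus.\<close>

lemma rooted_density_glue:
  assumes E: "is_plg E" and F: "is_plg F" and W: "finite W" "W \<noteq> {}"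
    and L: "finite L" "L \<subseteq> range Lab" "\<Union>E \<inter> range Lab \<subseteq> L" "\<Union>F \<inter> range Lab \<subseteq> L"
  shows "(\<Sum>\<phi>\<in>L \<rightarrow>\<^sub>E W. rooted_density W \<phi> G E * rooted_density W \<phi> G F)
    = card W ^ card L * hom_density W G (glue0 E F)"
proof -
  \<comment> \<open>The vertices of the glued graph together with the remaining labels of
    \<open>L\<close>.\<close>
  define D where "D = L \<union> (inl ` unl E \<union> inr ` unl F)"
  have nl: "inl v \<notin> range Lab" "inr v \<notin> range Lab" if "v \<notin> range Lab" for v
    using that by (cases v; auto)+
  have "label v = None" if "v \<in> unl A" for v A using that by (cases v) (auto simp: unl_def)
  then have "inl ` unl E \<inter> inr ` unl F = {}" by (auto simp: inl_eq_inr)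
  moreover have "L \<inter> (inl ` unl E \<union> inr ` unl F) = {}"
    using L(2) nl unfolding unl_def by blast
  ultimately have dj: "inl ` unl E \<inter> inr ` unl F = {}" "L \<inter> (inl ` unl E \<union> inr ` unl F) = {}" .
  have fin: "finite (unl E)" "finite (unl F)"
    using finite_Union_plg[OF E] finite_Union_plg[OF F] unfolding unl_def
    by (blast intro: finite_Diff)+
  have finD: "finite D" unfolding D_def using fin L(1) by simp
  have "card (inl ` unl E) = card (unl E)" "card (inr ` unl F) = card (unl F)"
    by (auto intro!: card_image simp: inj_on_def inl_inj inr_inj)
  then have cD: "card D = card L + (card (unl E) + card (unl F))"
    unfolding D_def using fin L(1) dj by (simp add: card_Un_disjoint)
  have inE: "inl v \<in> D" if "v \<in> \<Union>E" for v
  proof (cases "v \<in> range Lab")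
    case True
    then show ?thesis using that L(3) unfolding D_def by (auto simp del: Union_iff)
  next
    case False
    then show ?thesis using that unfolding D_def unl_def by blast
  qed
  have inF: "inr v \<in> D" if "v \<in> \<Union>F" for v
  proof (cases "v \<in> range Lab")
    case True
    then show ?thesis using that L(4) unfolding D_def by (auto simp del: Union_iff)
  next
    case False
    then show ?thesis using that unfolding D_def unl_def by blast
  qed
  have sub: "\<Union>(glue0 E F) \<subseteq> D" unfolding glue0_def using inE inF by auto
  let ?P = "\<lambda>\<phi>. {\<psi> \<in> unl E \<rightarrow>\<^sub>E W. (`) (extend \<phi> \<psi>) ` E \<subseteq> G}"
  let ?Q = "\<lambda>\<phi>. {\<psi> \<in> unl F \<rightarrow>\<^sub>E W. (`) (extend \<phi> \<psi>) ` F \<subseteq> G}"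
  let ?S = "SIGMA \<phi>:L \<rightarrow>\<^sub>E W. ?P \<phi> \<times> ?Q \<phi>"
  let ?C = "{\<psi> \<in> D \<rightarrow>\<^sub>E W. (`) \<psi> ` glue0 E F \<subseteq> G}"
  \<comment> \<open>Gluing puts the unlabeled vertices of the left factor at even indices and those
    of the right factor at odd ones, so parity selects the map and halving recovers the original
    vertex. \<open>r\<close> is the inverse of \<open>m\<close>.\<close>
  define m :: "(vertex \<Rightarrow> vertex) \<times> (vertex \<Rightarrow> vertex) \<times> (vertex \<Rightarrow> vertex) \<Rightarrow> vertex \<Rightarrow> vertex"
    where "m = (\<lambda>(\<phi>, \<alpha>, \<beta>). restrict (\<lambda>v. case v of Lab i \<Rightarrow> \<phi> v
       | Unl n \<Rightarrow> if even n then \<alpha> (Unl (n div 2)) else \<beta> (Unl (n div 2))) D)"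
  define r where "r \<psi> = (restrict \<psi> L, restrict (\<psi> \<circ> inl) (unl E), restrict (\<psi> \<circ> inr) (unl F))"
    for \<psi> :: "vertex \<Rightarrow> vertex"
  have mL: "m (\<phi>, \<alpha>, \<beta>) v = \<phi> v" if "v \<in> L" for \<phi> \<alpha> \<beta> v
    using that L(2) by (auto simp: m_def D_def)
  have mE: "m (\<phi>, \<alpha>, \<beta>) (inl v) = extend \<phi> \<alpha> v" if "v \<in> \<Union>E" for \<phi> \<alpha> \<beta> v
    using inE[OF that] by (cases v) (auto simp: m_def extend_def)
  have mF: "m (\<phi>, \<alpha>, \<beta>) (inr v) = extend \<phi> \<beta> v" if "v \<in> \<Union>F" for \<phi> \<alpha> \<beta> v
    using inF[OF that] by (cases v) (auto simp: m_def extend_def)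
  have mE': "m (\<phi>, \<alpha>, \<beta>) (inl v) = \<alpha> v" if "v \<in> unl E" for \<phi> \<alpha> \<beta> v
    using that mE[of v] by (auto simp: unl_def extend_def)
  have mF': "m (\<phi>, \<alpha>, \<beta>) (inr v) = \<beta> v" if "v \<in> unl F" for \<phi> \<alpha> \<beta> v
    using that mF[of v] by (auto simp: unl_def extend_def)
  have gi: "(`) f ` glue0 E F = (`) (f \<circ> inl) ` E \<union> (`) (f \<circ> inr) ` F" for f :: "vertex \<Rightarrow> vertex"
    by (simp add: glue0_def image_Un image_image image_comp)
  have "bij_betw m ?S ?C"
  proof (rule bij_betw_byWitness[where f' = r])
    show "\<forall>p\<in>?S. r (m p) = p"
    proof clarify
      fix \<phi> \<alpha> \<beta> assume p: "\<phi> \<in> L \<rightarrow>\<^sub>E W" "\<alpha> \<in> unl E \<rightarrow>\<^sub>E W" "\<beta> \<in> unl F \<rightarrow>\<^sub>E W"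
      have "restrict (m (\<phi>, \<alpha>, \<beta>)) L v = \<phi> v" for v
        using PiE_arb[OF p(1), of v] by (cases "v \<in> L") (simp_all add: mL)
      moreover have "restrict (m (\<phi>, \<alpha>, \<beta>) \<circ> inl) (unl E) v = \<alpha> v" for v
        using PiE_arb[OF p(2), of v] by (cases "v \<in> unl E") (simp_all add: mE')
      moreover have "restrict (m (\<phi>, \<alpha>, \<beta>) \<circ> inr) (unl F) v = \<beta> v" for v
        using PiE_arb[OF p(3), of v] by (cases "v \<in> unl F") (simp_all add: mF')
      ultimately show "r (m (\<phi>, \<alpha>, \<beta>)) = (\<phi>, \<alpha>, \<beta>)"
        unfolding r_def by (simp add: fun_eq_iff)
    qed
    show "\<forall>\<psi>\<in>?C. m (r \<psi>) = \<psi>"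
    proof clarify
      fix \<psi> assume p: "\<psi> \<in> D \<rightarrow>\<^sub>E W"
      show "m (r \<psi>) = \<psi>"
      proof
        fix v
        consider "v \<notin> D" | "v \<in> L" | w where "w \<in> unl E" "v = inl w" | w where "w \<in> unl F" "v = inr w"
          unfolding D_def by blast
        then show "m (r \<psi>) v = \<psi> v"
        proof cases
          case 1
          then show ?thesis using PiE_arb[OF p 1] by (simp add: m_def r_def)
        qed (simp_all add: r_def mL mE' mF')
      qed
    qed
    show "m ` ?S \<subseteq> ?C"
    proof clarify
      fix \<phi> \<alpha> \<beta> assume p: "\<phi> \<in> L \<rightarrow>\<^sub>E W"
        and a: "\<alpha> \<in> unl E \<rightarrow>\<^sub>E W" "(`) (extend \<phi> \<alpha>) ` E \<subseteq> G"
        and b: "\<beta> \<in> unl F \<rightarrow>\<^sub>E W" "(`) (extend \<phi> \<beta>) ` F \<subseteq> G"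
      have "m (\<phi>, \<alpha>, \<beta>) v \<in> W" if "v \<in> D" for v
        using that PiE_mem[OF p] PiE_mem[OF a(1)] PiE_mem[OF b(1)] unfolding D_def
        by (auto simp: mL mE' mF')
      then have "m (\<phi>, \<alpha>, \<beta>) \<in> D \<rightarrow>\<^sub>E W" by (intro PiE_I) (simp_all add: m_def)
      moreover have "(`) (m (\<phi>, \<alpha>, \<beta>) \<circ> inl) ` E = (`) (extend \<phi> \<alpha>) ` E"
        by (rule image_image_cong) (simp add: mE del: Union_iff)
      moreover have "(`) (m (\<phi>, \<alpha>, \<beta>) \<circ> inr) ` F = (`) (extend \<phi> \<beta>) ` F"
        by (rule image_image_cong) (simp add: mF del: Union_iff)
      ultimately show "m (\<phi>, \<alpha>, \<beta>) \<in> D \<rightarrow>\<^sub>E W \<and> (`) (m (\<phi>, \<alpha>, \<beta>)) ` glue0 E F \<subseteq> G"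
        unfolding gi using a(2) b(2) by simp
    qed
    show "r ` ?C \<subseteq> ?S"
    proof (rule image_subsetI)
      fix \<psi> assume "\<psi> \<in> ?C"
      then have p: "\<psi> \<in> D \<rightarrow>\<^sub>E W" "(`) \<psi> ` glue0 E F \<subseteq> G" by simp_all
      \<comment> \<open>Both embeddings fix labeled vertices, so the restriction to \<open>L\<close>
        is the placement seen by both factors.\<close>
      have lE: "inl v = v \<and> inr v = v" if "v \<in> range Lab" for v using that by auto
      have "(`) (extend (restrict \<psi> L) (restrict (\<psi> \<circ> inl) (unl E))) ` E = (`) (\<psi> \<circ> inl) ` E"
        by (rule image_image_cong) (use lE L(3) in \<open>auto simp: extend_def unl_def\<close>)
      moreover have "(`) (extend (restrict \<psi> L) (restrict (\<psi> \<circ> inr) (unl F))) ` F = (`) (\<psi> \<circ> inr) ` F"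
        by (rule image_image_cong) (use lE L(4) in \<open>auto simp: extend_def unl_def\<close>)
      moreover have "restrict \<psi> L \<in> L \<rightarrow>\<^sub>E W" "restrict (\<psi> \<circ> inl) (unl E) \<in> unl E \<rightarrow>\<^sub>E W"
        "restrict (\<psi> \<circ> inr) (unl F) \<in> unl F \<rightarrow>\<^sub>E W"
        using PiE_mem[OF p(1)] by (simp_all add: D_def)
      ultimately show "r \<psi> \<in> ?S" using p(2) unfolding r_def gi by simp
    qed
  qed
  then have "card ?C = card ?S" by (simp add: bij_betw_same_card)
  also have "card ?S = (\<Sum>\<phi>\<in>L \<rightarrow>\<^sub>E W. card (?P \<phi>) * card (?Q \<phi>))"
    using L(1) W(1) fin
    by (subst card_SigmaI) (simp_all add: finite_PiE card_cartesian_product)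
  finally have cC: "real (card ?C) = (\<Sum>\<phi>\<in>L \<rightarrow>\<^sub>E W. real (card (?P \<phi>)) * real (card (?Q \<phi>)))" by simp
  have "card W \<noteq> 0" using W by simp
  then show ?thesis
    unfolding hom_density_superset[OF finD sub W] rooted_density_def cC cD
    by (simp add: power_add sum_distrib_left sum_divide_distrib)
qed

subsection \<open>Rooted densities determine the graph\<close>

text \<open>Maps into \<open>G\<close> are sorted by the exact set of edges that they hit.\<close>

lemma rooted_density_eq_sum:
  assumes "finite G" "finite W" "finite (unl E)"
  shows "rooted_density W \<phi> G E = (\<Sum>G'\<in>Pow G. surj_density W \<phi> G' E)"
proof -
  let ?S = "\<lambda>G'. {\<psi> \<in> unl E \<rightarrow>\<^sub>E W. (`) (extend \<phi> \<psi>) ` E = G'}"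
  have "finite (unl E \<rightarrow>\<^sub>E W)" using assms by (intro finite_PiE) auto
  then have "card (\<Union>G'\<in>Pow G. ?S G') = (\<Sum>G'\<in>Pow G. card (?S G'))"
    using assms(1) by (intro card_UN_disjoint) auto
  moreover have "(\<Union>G'\<in>Pow G. ?S G') = {\<psi> \<in> unl E \<rightarrow>\<^sub>E W. (`) (extend \<phi> \<psi>) ` E \<subseteq> G}" by auto
  ultimately show ?thesis
    unfolding rooted_density_def surj_density_def by (simp add: sum_divide_distrib)
qed

text \<open>This is Moebius inversion over the subsets of \<open>G\<close>, done by induction: the
  surjective density at \<open>G\<close> is the rooted density minus the surjective densities at
  proper subsets.\<close>

lemma surj_density_eqI:
  assumes "finite W" "finite (unl E)" "finite (unl F)" "finite G"
    and "\<And>G'. G' \<subseteq> G \<Longrightarrow> rooted_density W \<phi> G' E = rooted_density W \<phi> G' F"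
  shows "surj_density W \<phi> G E = surj_density W \<phi> G F"
  using assms(4,5)
proof (induction G rule: finite_psubset_induct)
  case (psubset G)
  have split: "rooted_density W \<phi> G A = surj_density W \<phi> G A + (\<Sum>G'\<in>Pow G - {G}. surj_density W \<phi> G' A)"
    if "finite (unl A)" for A
    using psubset.hyps assms(1) that by (simp add: rooted_density_eq_sum sum.remove[of "Pow G" G])
  have "(\<Sum>G'\<in>Pow G - {G}. surj_density W \<phi> G' E) = (\<Sum>G'\<in>Pow G - {G}. surj_density W \<phi> G' F)"
    by (intro sum.cong refl psubset.IH psubset.prems) auto
  then show ?case using split[OF assms(2)] split[OF assms(3)] psubset.prems[of G] by simp
qed

text \<open>Take \<open>E\<close> itself as target, with every label placed at itself. The identity
  shows that the surjective density of \<open>E\<close> is nonzero; hence so is that of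
  \<open>F\<close>, and some map must be counted there.\<close>

lemma ex_surj_hom:
  assumes E: "is_plg E" "\<Union>E \<subseteq> W" and F: "is_plg F" and W: "finite W"
    and L: "\<Union>E \<inter> range Lab \<subseteq> L" "\<Union>F \<inter> range Lab \<subseteq> L" "L \<subseteq> W"
    and eq: "\<And>G \<phi>. G \<subseteq> Pow W \<Longrightarrow> \<phi> \<in> L \<rightarrow>\<^sub>E W \<Longrightarrow> rooted_density W \<phi> G E = rooted_density W \<phi> G F"
  shows "\<exists>\<theta>. (`) \<theta> ` F = E \<and> (\<forall>v\<in>\<Union>F \<inter> range Lab. \<theta> v = v)"
proof -
  \<comment> \<open>Restricted to \<open>L\<close>, because \<open>eq\<close> speaks of extensional
    placements only.\<close>
  let ?id = "restrict (\<lambda>v. v) L"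
  have fin: "finite (unl E)" "finite (unl F)" "finite E"
    using finite_Union_plg[OF E(1)] finite_Union_plg[OF F] E(1) unfolding unl_def is_plg_def
    by (blast intro: finite_Diff)+
  have "restrict (\<lambda>v. v) (unl E) \<in> {\<psi> \<in> unl E \<rightarrow>\<^sub>E W. (`) (extend ?id \<psi>) ` E = E}"
  proof -
    have "extend ?id (restrict (\<lambda>v. v) (unl E)) v = v" if "v \<in> \<Union>E" for v
      using that L(1) by (auto simp: extend_def unl_def)
    then have "(`) (extend ?id (restrict (\<lambda>v. v) (unl E))) ` E = (`) (\<lambda>v. v) ` E"
      by (intro image_cong refl) auto
    then show ?thesis using E(2) by (auto simp: unl_def)
  qed
  moreover have "finite {\<psi> \<in> unl E \<rightarrow>\<^sub>E W. (`) (extend ?id \<psi>) ` E = E}"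
    using fin W by (simp add: finite_PiE)
  ultimately have "card {\<psi> \<in> unl E \<rightarrow>\<^sub>E W. (`) (extend ?id \<psi>) ` E = E} \<noteq> 0"
    by (metis (no_types, lifting) card_0_eq empty_iff)
  \<comment> \<open>If \<open>W\<close> is empty, so is \<open>unl E\<close>, and the power is 0 ^ 0
    = 1.\<close>
  moreover have "card W ^ card (unl E) \<noteq> 0"
    using W E(2) fin(1) by (cases "W = {}") (auto simp: unl_def)
  ultimately have "surj_density W ?id E E \<noteq> 0" unfolding surj_density_def by simp
  \<comment> \<open>Every subset of \<open>E\<close> is a subset of \<open>Pow W\<close>, so
    \<open>eq\<close> applies to all targets that the inversion uses.\<close>
  moreover have "surj_density W ?id E E = surj_density W ?id E F"
    using E(2) L(3) by (intro surj_density_eqI fin W eq) auto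
  ultimately have "surj_density W ?id E F \<noteq> 0" by simp
  then have "card {\<psi> \<in> unl F \<rightarrow>\<^sub>E W. (`) (extend ?id \<psi>) ` F = E} \<noteq> 0"
    unfolding surj_density_def by (metis (no_types, lifting) div_0 of_nat_0)
  then obtain \<psi> where "(`) (extend ?id \<psi>) ` F = E"
    by (metis (mono_tags, lifting) card.empty ex_in_conv mem_Collect_eq)
  then show ?thesis
    using L(2) by (intro exI[of _ "extend ?id \<psi>"]) (auto simp: extend_def)
qed

text \<open>Without isolated vertices, surjectivity on edges gives surjectivity on vertices.
  Surjections both ways between finite sets force \<theta> to be injective, and it remains to see
  that \<theta> sends no unlabeled vertex to a label.\<close>

lemma plg_iso_if_surj_homs:
  assumes "is_plg E" "is_plg F"
    and t: "(`) \<theta> ` F = E" "\<forall>v\<in>\<Union>F \<inter> range Lab. \<theta> v = v"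
    and k: "(`) \<kappa> ` E = F" "\<forall>v\<in>\<Union>E \<inter> range Lab. \<kappa> v = v"
  shows "plg_iso F E"
proof -
  have U: "\<Union>E = \<theta> ` \<Union>F" "\<Union>F = \<kappa> ` \<Union>E"
    using image_Union[of \<theta> F] image_Union[of \<kappa> E] t(1) k(1) by simp_all
  have fin: "finite (\<Union>E)" "finite (\<Union>F)" using assms(1,2) by (auto intro: finite_Union_plg)
  have "card (\<theta> ` \<Union>F) = card (\<Union>F)"
    using U fin by (metis card_image_le le_antisym)
  then have inj: "inj_on \<theta> (\<Union>F)" using fin(2) by (simp add: eq_card_imp_inj_on)
  show ?thesis
  proof (rule plg_isoI[OF assms(2) inj _ t(1)[symmetric]])
    fix v assume v: "v \<in> \<Union>F"
    show "label (\<theta> v) = label v"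
    proof (cases v)
      case (Lab i) then show ?thesis using t(2) v by (metis IntI rangeI)
    next
      case (Unl n)
      \<comment> \<open>A label of \<open>E\<close> is fixed by \<kappa>, so it occurs in
        \<open>F\<close>, where \<theta> fixes it. By injectivity nothing else is sent to
        it.\<close>
      have False if "\<theta> v = Lab i" for i
      proof -
        have "Lab i \<in> \<Union>E" using U(1) v that by (metis imageI)
        then have "Lab i \<in> \<Union>F" using U(2) k(2) by (metis IntI imageI rangeI)
        moreover from this have "\<theta> (Lab i) = Lab i" using t(2) by (metis IntI rangeI)
        ultimately have "v = Lab i" using inj v that by (metis inj_onD)
        then show False using Unl by simp
      qed
      then show ?thesis using Unl by (cases "\<theta> v") auto
    qed
  qed
qed

subsection \<open>Representatives\<close>

lemma is_plg_rep: "is_plg (rep_plgraph H)"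
  using Quotient_rep_reflp[OF Quotient_plgraph] unfolding plg_iso_def by blast

lemma abs_rep_plgraph: "abs_plgraph (rep_plgraph H) = H"
  by (rule Quotient_abs_rep[OF Quotient_plgraph])

lemma rep_plgraph_iso_eq: "plg_iso (rep_plgraph H) (rep_plgraph K) \<Longrightarrow> H = K"
  by (metis Quotient_rel_rep[OF Quotient_plgraph])

lemma glue_rep: "glue H K = abs_plgraph (glue0 (rep_plgraph H) (rep_plgraph K))"
  by (simp add: glue_def)

section \<open>Degrees and densities of products\<close>

lemma graph_degree_glue:
  "graph_degree (glue H K) = card (glue0 (rep_plgraph H) (rep_plgraph K))"
  unfolding glue_rep
  by (rule graph_degree.abs_eq) (simp add: plg_iso_refl is_plg_glue0 is_plg_rep)

lemma graph_degree_unlabel [simp]: "graph_degree (unlabel H) = graph_degree H"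
proof transfer
  fix E assume "plg_iso E E"
  show "card ((`) strip ` E) = card E"
    by (rule card_image) (auto simp: inj_on_def strip_inj inj_image_eq_iff)
qed

lemma plg_density_unlabel [simp]: "plg_density W G (unlabel H) = plg_density W G H"
  by transfer (simp add: hom_density_image inj_on_def strip_inj)

lemma plg_density_glue:
  "plg_density W G (glue H K) = hom_density W G (glue0 (rep_plgraph H) (rep_plgraph K))"
  unfolding glue_rep
  by (rule plg_density.abs_eq) (simp add: plg_iso_refl is_plg_glue0 is_plg_rep)

text \<open>Inclusion-exclusion: an edge is doubled exactly when it lies in both graphs and both its
  ends are labeled, since \<open>inl\<close> and \<open>inr\<close> agree only on labels.\<close>

lemma card_glue0:
  assumes "is_plg E" "is_plg F"
  shows "card (glue0 E F) + card (E \<inter> F \<inter> Pow (range Lab)) = card E + card F"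
proof -
  have fin: "finite E" "finite F" using assms by (auto simp: is_plg_def)
  have fixed: "inl ` e = e" "inr ` e = e" if "e \<subseteq> range Lab" for e
  proof -
    have "inl v = v" "inr v = v" if "v \<in> e" for v using \<open>e \<subseteq> range Lab\<close> that by auto
    then show "inl ` e = e" "inr ` e = e" by simp_all
  qed
  have eqD: "e = e' \<and> e \<subseteq> range Lab" if "inl ` e = inr ` e'" for e e'
  proof -
    have "v \<in> e' \<and> v \<in> range Lab" if v: "v \<in> e" for v
    proof -
      from v \<open>inl ` e = inr ` e'\<close> obtain w where "w \<in> e'" "inl v = inr w" by (metis imageE imageI)
      then have "v \<in> e'" "label v \<noteq> None" using inl_eq_inr[of v w] by blast+
      then show ?thesis by (cases v) simp_all
    qed
    moreover have "v \<in> e" if v: "v \<in> e'" for v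
    proof -
      from v \<open>inl ` e = inr ` e'\<close> obtain w where "w \<in> e" "inl w = inr v" by (metis imageE imageI)
      then show ?thesis by (auto simp: inl_eq_inr)
    qed
    ultimately show ?thesis by blast
  qed
  have "(`) inl ` E \<inter> (`) inr ` F = E \<inter> F \<inter> Pow (range Lab)"
  proof (intro equalityI subsetI)
    fix x assume "x \<in> (`) inl ` E \<inter> (`) inr ` F"
    then obtain e e' where e: "e \<in> E" "e' \<in> F" "x = inl ` e" "x = inr ` e'" by blast
    then have "e = e'" "e \<subseteq> range Lab" using eqD[of e e'] by blast+
    then show "x \<in> E \<inter> F \<inter> Pow (range Lab)" using e fixed(1) by simp
  next
    fix x assume "x \<in> E \<inter> F \<inter> Pow (range Lab)"
    then show "x \<in> (`) inl ` E \<inter> (`) inr ` F"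
      using fixed[of x] by (metis IntE IntI PowD imageI)
  qed
  moreover have "card ((`) inl ` E) = card E" "card ((`) inr ` F) = card F"
    by (auto intro!: card_image simp: inj_on_def inj_image_eq_iff inl_inj inr_inj)
  ultimately show ?thesis
    unfolding glue0_def using fin card_Un_Int[of "(`) inl ` E" "(`) inr ` F"] by simp
qed

text \<open>A square \<open>HH\<close> merges all fully labeled edges of \<open>H\<close>, while
  \<open>HK\<close> merges only those shared with \<open>K\<close>. So each of the two squares loses
  at least as many edges as the mixed product.\<close>

lemma graph_degree_glue_mean:
  "graph_degree (glue H H) + graph_degree (glue K K) \<le> 2 * graph_degree (glue H K)"
proof -
  let ?E = "rep_plgraph H" and ?F = "rep_plgraph K" and ?L = "Pow (range Lab)"
  have fin: "finite ?E" "finite ?F" using is_plg_rep by (auto simp: is_plg_def)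
  have "card (?E \<inter> ?F \<inter> ?L) \<le> card (?E \<inter> ?E \<inter> ?L)" "card (?E \<inter> ?F \<inter> ?L) \<le> card (?F \<inter> ?F \<inter> ?L)"
    using fin by (auto intro!: card_mono)
  then show ?thesis
    unfolding graph_degree_glue
    using card_glue0[OF is_plg_rep[of H] is_plg_rep[of H]] card_glue0[OF is_plg_rep[of H] is_plg_rep[of K]]
      card_glue0[OF is_plg_rep[of K] is_plg_rep[of K]] by linarith
qed

text \<open>The squared distance of the vectors of \<open>H\<close> and \<open>K\<close> is the sum
  of the two squared lengths minus twice the inner product, hence at most M + M - 2M = 0. The
  threshold \<open>M\<close> is meant to be the largest value of \<beta> on the squares.\<close>

lemma ex_separating_functional:
  assumes "finite X"
  obtains \<beta> :: "plgraph \<Rightarrow> real" where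
    "\<And>H K M. H \<in> X \<Longrightarrow> K \<in> X \<Longrightarrow> \<beta> (unlabel (glue H H)) \<le> M \<Longrightarrow> \<beta> (unlabel (glue K K)) \<le> M
       \<Longrightarrow> M \<le> \<beta> (unlabel (glue H K)) \<Longrightarrow> H = K"
proof -
  \<comment> \<open>\<open>W\<close> holds all vertices of the representatives, so each of them is
    itself a target. \<open>Lab 1\<close> ensures that \<open>W\<close> is nonempty, even if no
    graph in \<open>X\<close> has a vertex.\<close>
  define W where "W = insert (Lab 1) (\<Union>H\<in>X. \<Union>(rep_plgraph H))"
  define L where "L = W \<inter> range Lab"
  define I where "I = Pow (Pow W) \<times> (L \<rightarrow>\<^sub>E W)"
  define v where "v H = (\<lambda>(G, \<phi>). rooted_density W \<phi> G (rep_plgraph H))" for H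
  \<comment> \<open>The factor is the number of placements of \<open>L\<close>: it turns the density
    of the glued graph into a sum over placements, as in \<open>rooted_density_glue\<close>.\<close>
  define \<beta> where "\<beta> F = card W ^ card L * (\<Sum>G\<in>Pow (Pow W). plg_density W G F)" for F
  have W: "finite W" "W \<noteq> {}"
    using assms by (auto simp: W_def intro: finite_Union_plg is_plg_rep simp del: finite_Union)
  have L: "finite L" "L \<subseteq> range Lab" "L \<subseteq> W" using W by (auto simp: L_def)
  have XW: "\<Union>(rep_plgraph H) \<subseteq> W" if "H \<in> X" for H using that by (auto simp: W_def)
  have XL: "\<Union>(rep_plgraph H) \<inter> range Lab \<subseteq> L" if "H \<in> X" for H using XW[OF that] by (auto simp: L_def)
  have finI: "finite I" unfolding I_def using W L by (auto intro!: finite_PiE)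
  have ip: "\<beta> (unlabel (glue H K)) = (\<Sum>x\<in>I. v H x * v K x)" if "H \<in> X" "K \<in> X" for H K
  proof -
    have "(\<Sum>x\<in>I. v H x * v K x) = (\<Sum>G\<in>Pow (Pow W). \<Sum>\<phi>\<in>L \<rightarrow>\<^sub>E W.
        rooted_density W \<phi> G (rep_plgraph H) * rooted_density W \<phi> G (rep_plgraph K))"
      unfolding I_def v_def by (simp add: sum.cartesian_product case_prod_unfold)
    also have "\<dots> = \<beta> (unlabel (glue H K))"
      unfolding rooted_density_glue[OF is_plg_rep is_plg_rep W L(1,2) XL[OF that(1)] XL[OF that(2)]]
      by (simp add: \<beta>_def plg_density_glue sum_distrib_left)
    finally show ?thesis by simp
  qed
  show ?thesis
  proof (rule that[of \<beta>])
    fix H K M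
    assume X: "H \<in> X" "K \<in> X" and "\<beta> (unlabel (glue H H)) \<le> M" "\<beta> (unlabel (glue K K)) \<le> M"
      "M \<le> \<beta> (unlabel (glue H K))"
    moreover have "(\<Sum>x\<in>I. (v H x - v K x)\<^sup>2)
        = (\<Sum>x\<in>I. v H x * v H x) + (\<Sum>x\<in>I. v K x * v K x) - 2 * (\<Sum>x\<in>I. v H x * v K x)"
      by (simp add: power2_eq_square algebra_simps sum.distrib sum_subtractf sum_distrib_left)
    ultimately have "(\<Sum>x\<in>I. (v H x - v K x)\<^sup>2) \<le> 0" by (simp add: ip)
    then have "(\<Sum>x\<in>I. (v H x - v K x)\<^sup>2) = 0" by (intro antisym sum_nonneg) auto
    then have "\<forall>x\<in>I. v H x = v K x" using finI by (simp add: sum_nonneg_eq_0_iff)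
    then have eq: "rooted_density W \<phi> G (rep_plgraph H) = rooted_density W \<phi> G (rep_plgraph K)"
      if "G \<subseteq> Pow W" "\<phi> \<in> L \<rightarrow>\<^sub>E W" for G \<phi> using that by (auto simp: I_def v_def)
    \<comment> \<open>Equality of the densities is symmetric, so each representative maps onto the
      other.\<close>
    obtain \<theta> \<kappa> where "(`) \<theta> ` rep_plgraph K = rep_plgraph H"
      "\<forall>v\<in>\<Union>(rep_plgraph K) \<inter> range Lab. \<theta> v = v"
      "(`) \<kappa> ` rep_plgraph H = rep_plgraph K" "\<forall>v\<in>\<Union>(rep_plgraph H) \<inter> range Lab. \<kappa> v = v"
      using ex_surj_hom[OF is_plg_rep XW[OF X(1)] is_plg_rep W(1) XL[OF X(1)] XL[OF X(2)] L(3) eq]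
        ex_surj_hom[OF is_plg_rep XW[OF X(2)] is_plg_rep W(1) XL[OF X(2)] XL[OF X(1)] L(3) eq[symmetric]]
      by metis
    then have "plg_iso (rep_plgraph K) (rep_plgraph H)"
      by (rule plg_iso_if_surj_homs[OF is_plg_rep is_plg_rep])
    then show "H = K" using rep_plgraph_iso_eq by metis
  qed
qed

subsection \<open>Coefficients of a sum of squares\<close>

text \<open>Allows two combinations and their sum, whose keys may cancel, to be expanded over one
  index set.\<close>

lemma unlabel_comb_superset:
  assumes "finite A" "Poly_Mapping.keys a \<subseteq> A"
  shows "unlabel_comb a = (\<Sum>H\<in>A. Poly_Mapping.single (unlabel H) (Poly_Mapping.lookup a H))"
  unfolding unlabel_comb_def using assms
  by (intro sum.mono_neutral_left) (auto simp: in_keys_iff)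

lemma unlabel_comb_add: "unlabel_comb (a + b) = unlabel_comb a + unlabel_comb b"
proof -
  let ?A = "Poly_Mapping.keys a \<union> Poly_Mapping.keys b"
  have "unlabel_comb c = (\<Sum>H\<in>?A. Poly_Mapping.single (unlabel H) (Poly_Mapping.lookup c H))"
    if "Poly_Mapping.keys c \<subseteq> ?A" for c
    using that by (intro unlabel_comb_superset) auto
  then show ?thesis
    using keys_add[of a b] by (simp add: lookup_add single_add sum.distrib)
qed

lemma unlabel_comb_sum: "unlabel_comb (\<Sum>x\<in>A. g x) = (\<Sum>x\<in>A. unlabel_comb (g x))"
proof (induction A rule: infinite_finite_induct)
qed (simp_all add: unlabel_comb_add, simp_all add: unlabel_comb_def)

lemma unlabel_comb_single [simp]:
  "unlabel_comb (Poly_Mapping.single H c) = Poly_Mapping.single (unlabel H) c"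
  by (cases "c = 0") (simp_all add: unlabel_comb_def)

lemma lookup_unlabel_comb_square:
  "Poly_Mapping.lookup (unlabel_comb (a\<^sup>2)) F =
     (\<Sum>H\<in>Poly_Mapping.keys a. \<Sum>K\<in>Poly_Mapping.keys a.
        if unlabel (glue H K) = F then Poly_Mapping.lookup a H * Poly_Mapping.lookup a K else 0)"
proof -
  have "a\<^sup>2 = (\<Sum>H\<in>Poly_Mapping.keys a. Poly_Mapping.single H (Poly_Mapping.lookup a H))
      * (\<Sum>K\<in>Poly_Mapping.keys a. Poly_Mapping.single K (Poly_Mapping.lookup a K))"
    unfolding power2_eq_square using graph_comb_expansion[of a] by simp
  also have "\<dots> = (\<Sum>H\<in>Poly_Mapping.keys a. \<Sum>K\<in>Poly_Mapping.keys a.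
      Poly_Mapping.single (glue H K) (Poly_Mapping.lookup a H * Poly_Mapping.lookup a K))"
    by (simp add: sum_product graph_comb_mult_single)
  finally have "unlabel_comb (a\<^sup>2) = (\<Sum>H\<in>Poly_Mapping.keys a. \<Sum>K\<in>Poly_Mapping.keys a.
      Poly_Mapping.single (unlabel (glue H K)) (Poly_Mapping.lookup a H * Poly_Mapping.lookup a K))"
    by (simp add: unlabel_comb_sum)
  then show ?thesis by (simp add: lookup_sum lookup_single when_def)
qed

section \<open>Choice of the term of minimum degree\<close>

theorem lemma2p4:
  fixes f :: graph_comb
    and I :: "'i set"
    and a :: "'i \<Rightarrow> graph_comb"
    and d :: nat
  assumes "finite I"
    and "\<exists>i\<in>I. a i \<noteq> 0"
    and "f = (\<Sum>i\<in>I. unlabel_comb ((a i)\<^sup>2))"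
    and "d = Min {graph_degree (glue H K) | i H K.
      i \<in> I \<and> H \<in> Poly_Mapping.keys (a i) \<and> K \<in> Poly_Mapping.keys (a i)}"
  shows "\<exists>F\<in>Poly_Mapping.keys f. graph_degree F = d
           \<and> (\<forall>i\<in>I. \<forall>H\<in>Poly_Mapping.keys (a i). \<forall>K\<in>Poly_Mapping.keys (a i).
                F = unlabel (glue H K) \<longrightarrow> H = K)
           \<and> Poly_Mapping.lookup f F > 0"
proof -
  let ?k = "\<lambda>i. Poly_Mapping.keys (a i)"
  let ?D = "{graph_degree (glue H K) | i H K. i \<in> I \<and> H \<in> ?k i \<and> K \<in> ?k i}"
  have "?D = (\<lambda>(i, H, K). graph_degree (glue H K)) ` (SIGMA i:I. ?k i \<times> ?k i)" by force
  then have finD: "finite ?D" using assms(1) by auto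
  have le: "d \<le> graph_degree (glue H K)" if "i \<in> I" "H \<in> ?k i" "K \<in> ?k i" for i H K
    unfolding assms(4) using that by (intro Min_le finD) blast
  \<comment> \<open>Both squares have degree at least \<open>d\<close>, and their mean degree is at
    most that of \<open>HK\<close>.\<close>
  have sq: "graph_degree (glue H H) = d \<and> graph_degree (glue K K) = d"
    if "i \<in> I" "H \<in> ?k i" "K \<in> ?k i" "graph_degree (glue H K) = d" for i H K
    using graph_degree_glue_mean[of H K] le[OF that(1,2,2)] le[OF that(1,3,3)] that(4) by linarith
  \<comment> \<open>The graphs are collected over all \<open>i\<close>, because products from
    different \<open>a i\<close> can yield the same unlabeled graph.\<close>
  define X where "X = {H \<in> \<Union>i\<in>I. ?k i. graph_degree (glue H H) = d}"
  have finX: "finite X" using assms(1) by (simp add: X_def)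
  have "?D \<noteq> {}" using assms(2) by (force simp: keys_eq_empty[symmetric] simp del: keys_eq_empty)
  from Min_in[OF finD this] obtain i H K where "i \<in> I" "H \<in> ?k i" "K \<in> ?k i" "graph_degree (glue H K) = d"
    unfolding assms(4) by auto
  with sq have "X \<noteq> {}" unfolding X_def by blast
  from ex_separating_functional[OF finX] obtain \<beta> :: "plgraph \<Rightarrow> real" where
    \<beta>: "\<And>H K M. H \<in> X \<Longrightarrow> K \<in> X \<Longrightarrow> \<beta> (unlabel (glue H H)) \<le> M \<Longrightarrow> \<beta> (unlabel (glue K K)) \<le> M
       \<Longrightarrow> M \<le> \<beta> (unlabel (glue H K)) \<Longrightarrow> H = K" by blast
  let ?q = "\<lambda>H. \<beta> (unlabel (glue H H))"
  obtain H0 where H0: "H0 \<in> X" "\<And>H. H \<in> X \<Longrightarrow> ?q H \<le> ?q H0"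
    using finX \<open>X \<noteq> {}\<close> Max_in[of "?q ` X"] Max_ge[of "?q ` X"] by fastforce
  define F where "F = unlabel (glue H0 H0)"
  have deg: "graph_degree F = d" using H0(1) by (simp add: F_def X_def)
  \<comment> \<open>Any product giving \<open>F\<close> has degree \<open>d\<close>, which puts both
    factors into \<open>X\<close>. Maximality of \<open>H0\<close> then supplies the threshold
    \<open>M\<close> = \<beta> \<open>F\<close>.\<close>
  have only: "H = K" if "i \<in> I" "H \<in> ?k i" "K \<in> ?k i" "F = unlabel (glue H K)" for i H K
  proof -
    have "graph_degree (glue H K) = d" using deg that(4) by simp
    then have "H \<in> X" "K \<in> X" using sq[OF that(1-3)] that(1-3) by (auto simp: X_def)
    then show ?thesis using \<beta>[of H K "?q H0"] H0(2) that(4) by (simp add: F_def)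
  qed
  \<comment> \<open>By \<open>only\<close>, the off-diagonal products contribute nothing to the
    coefficient of \<open>F\<close>.\<close>
  have lk: "Poly_Mapping.lookup f F
      = (\<Sum>i\<in>I. \<Sum>H\<in>?k i. if unlabel (glue H H) = F then (Poly_Mapping.lookup (a i) H)\<^sup>2 else 0)"
    unfolding assms(3) lookup_sum lookup_unlabel_comb_square
  proof (intro sum.cong refl)
    fix i H assume iH: "i \<in> I" "H \<in> ?k i"
    have "(\<Sum>K\<in>?k i. if unlabel (glue H K) = F then Poly_Mapping.lookup (a i) H * Poly_Mapping.lookup (a i) K else 0)
        = (\<Sum>K\<in>?k i. if K = H then (if unlabel (glue H H) = F then (Poly_Mapping.lookup (a i) H)\<^sup>2 else 0) else 0)"
      using only[OF iH] by (intro sum.cong refl) (auto simp: power2_eq_square)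
    then show "(\<Sum>K\<in>?k i. if unlabel (glue H K) = F then Poly_Mapping.lookup (a i) H * Poly_Mapping.lookup (a i) K else 0)
        = (if unlabel (glue H H) = F then (Poly_Mapping.lookup (a i) H)\<^sup>2 else 0)"
      using iH(2) by simp
  qed
  \<comment> \<open>The nonzero coefficient of \<open>H0\<close> in \<open>a j\<close> makes one
    summand positive; the others are sums of squares.\<close>
  obtain j where j: "j \<in> I" "H0 \<in> ?k j" using H0(1) by (auto simp: X_def)
  have "0 < Poly_Mapping.lookup f F"
    unfolding lk
  proof (rule sum_pos2[OF assms(1) j(1)])
    show "0 < (\<Sum>H\<in>?k j. if unlabel (glue H H) = F then (Poly_Mapping.lookup (a j) H)\<^sup>2 else 0)"
      by (rule sum_pos2[OF _ j(2)]) (use j(2) in \<open>auto simp: F_def in_keys_iff\<close>)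
  qed (auto intro!: sum_nonneg)
  moreover from this have "F \<in> Poly_Mapping.keys f" by (simp add: in_keys_iff)
  ultimately show ?thesis using deg only by blast
qed

end
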